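(* Let $\beta>0$ and suppose $\hat x$ is a global minimizer of the problem $$\min_{x\in\mathcal X}\ \mathcal F_\beta(x)=x^\top D x+\beta\|x\|_0 .$$ Then $$\|\hat x\|_\infty\le \sqrt{\frac{\eta}{s_N(D)}}<\infty,\qquad\text{where}\qquad \eta=\min_{1\le i\le N}\left\{\frac{\bar{\mathfrak r}^2 D_{ii}}{\left(|\mathfrak r[i]|-\gamma\sqrt{D_{ii}}\right)^2}\right\}.$$
   Context: Data: $N\ge 1$; $D\in\mathbb R^{N\times N}$ is a symmetric positive definite matrix with diagonal entries $D_{ii}$; $\hat r\in\mathbb R^N$; $r_c,\bar r\in\mathbb R$; $\gamma>0$. Set $\mathfrak r=\hat r-r_c\mathbf 1\in\mathbb R^N$ (with entries $\mathfrak r[i]$, where $\mathbf 1$ is the all-ones vector) and $\bar{\mathfrak r}=\bar r-r_c$. Notation: $\|x\|_D=\sqrt{x^\top D x}$; $\|x\|_0$ is the number of nonzero entries of $x$; $\|x\|_\infty=\max_i|x[i]|$; $s_N(D)$ is the smallest singular value of $D$. The feasible set is $\mathcal X=\{x\in\mathbb R^N:\ \mathfrak r^\top x-\gamma\|x\|_D\ge\bar{\mathfrak r}\}$. Standing assumptions: (1) $\bar r>r_c$, i.e. $\bar{\mathfrak r}>0$; (2) $\min_{1\le i\le N}|\mathfrak r[i]|/\sqrt{D_{ii}}>\gamma$. *)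

theory Defs
  imports "HOL-Analysis.Analysis"
begin

definition symmetric_pos_def :: "real^'n^'n \<Rightarrow> bool" where
  "symmetric_pos_def D \<longleftrightarrow> transpose D = D \<and> (\<forall>x. x \<noteq> 0 \<longrightarrow> 0 < x \<bullet> (D *v x))"

definition norm_wrt :: "real^'n^'n \<Rightarrow> real^'n \<Rightarrow> real" where
  "norm_wrt D x = sqrt (x \<bullet> (D *v x))"

definition norm0 :: "real^'n \<Rightarrow> nat" where
  "norm0 x = card {i. x $ i \<noteq> 0}"

definition eigenvalues :: "real^'n^'n \<Rightarrow> real set" where
  "eigenvalues A = {l. \<exists>v. v \<noteq> 0 \<and> A *v v = l *\<^sub>R v}"

text \<open>
  Since multiplicities are ignored, this is a set; it is finite and nonempty, so that
  its minimum is the last entry of the decreasingly ordered list of singular values.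
\<close>
definition singular_values :: "real^'n^'n \<Rightarrow> real set" where
  "singular_values A = sqrt ` eigenvalues (transpose A ** A)"

definition smallest_singular_value :: "real^'n^'n \<Rightarrow> real" where
  "smallest_singular_value A = Min (singular_values A)"

definition feasible_set :: "real^'n^'n \<Rightarrow> real^'n \<Rightarrow> real \<Rightarrow> real \<Rightarrow> (real^'n) set" where
  "feasible_set D r \<rho> \<gamma> = {x. r \<bullet> x - \<gamma> * norm_wrt D x \<ge> \<rho>}"

definition objective :: "real^'n^'n \<Rightarrow> real \<Rightarrow> real^'n \<Rightarrow> real" where
  "objective D \<beta> x = x \<bullet> (D *v x) + \<beta> * real (norm0 x)"

end

theory Submission
  imports Defs
begin

text \<open>
  The bound compares the minimizer with the cheapest portfolio invested in a single asset.
  Since \<open>\<bar>r $ i\<bar> > \<gamma> * sqrt (D $ i $ i)\<close>, the ray spanned by \<open>sgn (r $ i)\<close> times the unit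
  vector \<open>axis i 1\<close> enters the feasible set, and the point at which it enters has the
  quadratic cost \<open>\<rho>\<^sup>2 * D $ i $ i / (\<bar>r $ i\<bar> - \<gamma> * sqrt (D $ i $ i))\<^sup>2\<close>
  (\<open>single_asset_feasible\<close>). For the best index \<open>i\<close> this cost is \<open>\<eta>\<close>. The
  minimizer is nonzero, because \<open>\<rho> > 0\<close> makes the origin infeasible; its support thus has at
  least one element, the support size of the competitor. It therefore pays at least the same
  penalty, and optimality leaves \<open>x \<bullet> (D *v x) \<le> \<eta>\<close> for the minimizer \<open>x\<close>.

  Coercivity turns this into a bound on \<open>x\<close>: a minimizer of the quadratic form on the unit
  sphere is an eigenvector of \<open>D\<close> (\<open>rayleigh_minimum_eigenvector\<close>), and its eigenvalue is
  a singular value. Hence the quadratic form is at least \<open>smallest_singular_value D\<close> times the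
  squared norm, and the maximum norm is at most the Euclidean norm.
\<close>

lemma symmetric_inner_swap:
  fixes A :: "real^'n^'n"
  assumes "transpose A = A"
  shows "x \<bullet> (A *v y) = (A *v x) \<bullet> y"
  by (metis assms dot_lmul_matrix transpose_matrix_vector)

text \<open>
  Eigenvectors of a symmetric matrix for distinct eigenvalues are orthogonal, hence linearly
  independent, so there is room for only finitely many.
\<close>
lemma finite_eigenvalues_symmetric:
  fixes A :: "real^'n^'n"
  assumes sym: "transpose A = A"
  shows "finite (eigenvalues A)"
proof -
  have "\<forall>l \<in> eigenvalues A. \<exists>v. v \<noteq> 0 \<and> A *v v = l *\<^sub>R v"
    by (simp add: eigenvalues_def)
  then obtain e where e: "\<And>l. l \<in> eigenvalues A \<Longrightarrow> e l \<noteq> 0 \<and> A *v e l = l *\<^sub>R e l"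
    by metis
  have orth: "e k \<bullet> e l = 0"
    if "k \<in> eigenvalues A" "l \<in> eigenvalues A" "k \<noteq> l" for k l
  proof -
    have "l * (e k \<bullet> e l) = k * (e k \<bullet> e l)"
      using symmetric_inner_swap[OF sym, of "e k" "e l"] e that by simp
    then show ?thesis using \<open>k \<noteq> l\<close> by simp
  qed
  have "inj_on e (eigenvalues A)"
    by (rule inj_onI) (metis e inner_eq_zero_iff orth)
  moreover have "independent (e ` eigenvalues A)"
  proof (rule pairwise_orthogonal_independent)
    show "pairwise orthogonal (e ` eigenvalues A)"
      by (auto simp: pairwise_def orthogonal_def intro: orth)
    show "0 \<notin> e ` eigenvalues A"
      using e by force
  qed
  then have "finite (e ` eigenvalues A)"
    by (rule independent_imp_finite)
  ultimately show ?thesis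
    using finite_imageD by blast
qed

text \<open>
  At a null vector \<open>v\<close> the form attains its minimum, so its gradient \<open>2 * (B *v v)\<close>
  vanishes there: otherwise a step from \<open>v\<close> against the gradient would make the form
  negative.
\<close>
lemma psd_null_vector:
  fixes B :: "real^'n^'n"
  assumes sym: "transpose B = B"
    and psd: "\<And>x. 0 \<le> x \<bullet> (B *v x)"
    and null: "v \<bullet> (B *v v) = 0"
  shows "B *v v = 0"
proof (rule ccontr)
  define w where "w = B *v v"
  define a c where "a = w \<bullet> w" and "c = w \<bullet> (B *v w)"
  assume "B *v v \<noteq> 0"
  then have a: "a > 0"
    by (simp add: a_def w_def)
  have c: "c \<ge> 0"
    using psd by (simp add: c_def)
  \<comment> \<open>Along \<open>w\<close> the form is \<open>t * (2 * a + t * c)\<close>, negative for \<open>t < 0\<close> with \<open>- t * c < 2 * a\<close>;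
    the \<open>+ 1\<close> covers \<open>c = 0\<close>.\<close>
  define t where "t = - a / (c + 1)"
  have "v \<bullet> (B *v w) = a"
    by (simp add: symmetric_inner_swap[OF sym] a_def flip: w_def)
  moreover have "w \<bullet> (B *v v) = a"
    by (simp add: a_def flip: w_def)
  ultimately have "(v + t *\<^sub>R w) \<bullet> (B *v (v + t *\<^sub>R w)) = t * (2 * a + t * c)"
    using null
    by (simp add: matrix_vector_mult_scaleR matrix_vector_right_distrib inner_add_left
        inner_add_right c_def algebra_simps)
  then have "0 \<le> t * (2 * a + t * c)"
    using psd by metis
  moreover have "2 * a + t * c > 0"
    using a c by (simp add: t_def field_simps add_nonneg_pos)
  moreover have "t < 0"
    using a c by (simp add: t_def field_simps)
  ultimately show False
    by (simp add: zero_le_mult_iff)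
qed

text \<open>
  By compactness the form attains a minimum \<open>l\<close> on the unit sphere, at some \<open>v\<close>. After
  subtracting \<open>l\<close> times the identity the form is positive semidefinite and vanishes at
  \<open>v\<close>, so \<open>v\<close> is in the kernel of the shifted matrix.
\<close>
lemma rayleigh_minimum_eigenvector:
  fixes A :: "real^'n^'n"
  assumes sym: "transpose A = A"
  shows "\<exists>l v. v \<noteq> 0 \<and> A *v v = l *\<^sub>R v \<and> (\<forall>x. l * (norm x)\<^sup>2 \<le> x \<bullet> (A *v x))"
proof -
  have "continuous_on (sphere 0 1) (\<lambda>x. x \<bullet> (A *v x))"
    by (intro continuous_intros)
  moreover have "sphere (0::real^'n) 1 \<noteq> {}" "compact (sphere (0::real^'n) 1)"
    by simp_all
  ultimately obtain v where v: "norm v = 1"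
    and v_min: "\<And>y. norm y = 1 \<Longrightarrow> v \<bullet> (A *v v) \<le> y \<bullet> (A *v y)"
    using continuous_attains_inf[of "sphere 0 1" "\<lambda>x. x \<bullet> (A *v x)"] by auto
  define l where "l = v \<bullet> (A *v v)"
  have bound: "l * (norm x)\<^sup>2 \<le> x \<bullet> (A *v x)" for x
  proof (cases "x = 0")
    case False
    define y where "y = (1 / norm x) *\<^sub>R x"
    have "norm y = 1"
      using False by (simp add: y_def)
    then have "l \<le> y \<bullet> (A *v y)"
      using v_min by (simp add: l_def)
    also have "\<dots> = x \<bullet> (A *v x) / (norm x)\<^sup>2"
      by (simp add: y_def matrix_vector_mult_scaleR power2_eq_square)
    finally show ?thesis
      using False by (simp add: pos_le_divide_eq)
  qed simp
  define B where "B = A - l *\<^sub>R mat 1"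
  have B: "B *v x = A *v x - l *\<^sub>R x" for x
    by (simp add: B_def matrix_vector_mult_diff_rdistrib flip: scaleR_matrix_vector_assoc)
  have "B *v v = 0"
  proof (rule psd_null_vector)
    show "transpose B = B"
      using sym by (simp add: B_def transpose_def mat_def vec_eq_iff)
    show "0 \<le> x \<bullet> (B *v x)" for x
      using bound[of x] by (simp add: B inner_diff_right power2_norm_eq_inner)
    show "v \<bullet> (B *v v) = 0"
      using v by (simp add: B inner_diff_right l_def norm_eq_1)
  qed
  then have "A *v v = l *\<^sub>R v"
    by (simp add: B)
  moreover have "v \<noteq> 0"
    using v by auto
  ultimately show ?thesis
    using bound by blast
qed

text \<open>
  The least Rayleigh quotient \<open>l\<close> of \<open>D\<close> is an eigenvalue, so \<open>l\<^sup>2\<close> is one of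
  \<open>transpose D ** D\<close> and \<open>l\<close> itself a singular value. Being the minimum, the smallest
  singular value is then at most \<open>l\<close>, which is the inequality that coercivity requires.
\<close>
lemma smallest_singular_value_pos_def:
  fixes D :: "real^'n^'n"
  assumes D: "symmetric_pos_def D"
  shows smallest_singular_value_pos: "0 < smallest_singular_value D"
    and smallest_singular_value_coercive:
      "smallest_singular_value D * (norm x)\<^sup>2 \<le> x \<bullet> (D *v x)"
proof -
  have sym: "transpose D = D" and pos: "\<And>x. x \<noteq> 0 \<Longrightarrow> 0 < x \<bullet> (D *v x)"
    using D by (auto simp: symmetric_pos_def_def)
  obtain l v where v: "v \<noteq> 0" "D *v v = l *\<^sub>R v"
    and rayleigh: "\<And>x. l * (norm x)\<^sup>2 \<le> x \<bullet> (D *v x)"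
    using rayleigh_minimum_eigenvector[OF sym] by metis
  have "0 < l"
    using pos[OF v(1)] v by (simp add: zero_less_mult_iff flip: power2_norm_eq_inner)
  have "(transpose D ** D) *v v = l\<^sup>2 *\<^sub>R v"
    using v by (simp add: sym matrix_vector_mult_scaleR power2_eq_square
        flip: matrix_vector_mul_assoc)
  then have "l\<^sup>2 \<in> eigenvalues (transpose D ** D)"
    using v by (auto simp: eigenvalues_def)
  then have "sqrt (l\<^sup>2) \<in> singular_values D"
    unfolding singular_values_def by (rule imageI)
  then have l_in: "l \<in> singular_values D"
    using \<open>0 < l\<close> by simp
  have "transpose (transpose D ** D) = transpose D ** D"
    by (simp add: matrix_transpose_mul)
  then have fin: "finite (singular_values D)"
    unfolding singular_values_def by (intro finite_imageI finite_eigenvalues_symmetric)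
  have sv_pos: "0 < s" if s_in: "s \<in> singular_values D" for s
  proof -
    obtain m w where w: "w \<noteq> 0" "(transpose D ** D) *v w = m *\<^sub>R w" and s: "s = sqrt m"
      using s_in by (auto simp: singular_values_def eigenvalues_def)
    have "D *v w \<noteq> 0"
      using pos[OF w(1)] by auto
    then have "0 < (D *v w) \<bullet> (D *v w)"
      by simp
    also have "\<dots> = w \<bullet> ((transpose D ** D) *v w)"
      by (simp add: sym symmetric_inner_swap[OF sym] flip: matrix_vector_mul_assoc)
    also have "\<dots> = m * (w \<bullet> w)"
      by (simp add: w)
    finally show ?thesis
      using w s by (simp add: zero_less_mult_iff flip: power2_norm_eq_inner)
  qed
  have "smallest_singular_value D \<in> singular_values D"
    unfolding smallest_singular_value_def using fin l_in by (intro Min_in) auto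
  then show "0 < smallest_singular_value D"
    by (rule sv_pos)
  have "smallest_singular_value D \<le> l"
    unfolding smallest_singular_value_def using fin l_in by (rule Min_le)
  then have "smallest_singular_value D * (norm x)\<^sup>2 \<le> l * (norm x)\<^sup>2"
    by (rule mult_right_mono) simp
  then show "smallest_singular_value D * (norm x)\<^sup>2 \<le> x \<bullet> (D *v x)"
    using rayleigh[of x] by linarith
qed

lemma quadratic_form_axis:
  fixes A :: "real^'n^'n"
  shows "axis i t \<bullet> (A *v axis i t) = t\<^sup>2 * A $ i $ i"
proof -
  have "(A *v axis i t) $ i = t * A $ i $ i"
    by (simp add: matrix_vector_mul_component inner_axis)
  then show ?thesis
    by (simp add: inner_axis' power2_eq_square)
qed

text \<open>
  The sign of the position in asset \<open>i\<close> makes its excess return positive, and its size makes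
  the return constraint tight.
\<close>
lemma single_asset_feasible:
  fixes D :: "real^'n^'n" and r :: "real^'n"
  assumes d: "0 < D $ i $ i"
    and \<rho>: "0 < \<rho>" and \<gamma>: "0 < \<gamma>"
    and excess: "\<gamma> * sqrt (D $ i $ i) < \<bar>r $ i\<bar>"
  obtains w where "w \<in> feasible_set D r \<rho> \<gamma>" "norm0 w = 1"
    "w \<bullet> (D *v w) = \<rho>\<^sup>2 * D $ i $ i / (\<bar>r $ i\<bar> - \<gamma> * sqrt (D $ i $ i))\<^sup>2"
proof -
  define k where "k = \<bar>r $ i\<bar> - \<gamma> * sqrt (D $ i $ i)"
  define t where "t = sgn (r $ i) * (\<rho> / k)"
  have k: "0 < k"
    using excess by (simp add: k_def)
  have "0 \<le> \<gamma> * sqrt (D $ i $ i)"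
    using d \<gamma> by simp
  then have "r $ i \<noteq> 0"
    using excess by auto
  then have abs_t: "\<bar>t\<bar> = \<rho> / k"
    using \<rho> k by (simp add: t_def abs_mult abs_sgn_eq)
  have "t\<^sup>2 = \<rho>\<^sup>2 / k\<^sup>2"
    by (metis abs_t power2_abs power_divide)
  then have form: "axis i t \<bullet> (D *v axis i t) = \<rho>\<^sup>2 * D $ i $ i / k\<^sup>2"
    by (simp add: quadratic_form_axis)
  have "r \<bullet> axis i t = \<bar>r $ i\<bar> * (\<rho> / k)"
    by (simp add: inner_axis t_def abs_sgn mult_ac)
  moreover have "norm_wrt D (axis i t) = (\<rho> / k) * sqrt (D $ i $ i)"
    by (simp add: norm_wrt_def quadratic_form_axis real_sqrt_mult abs_t)
  ultimately have "r \<bullet> axis i t - \<gamma> * norm_wrt D (axis i t) = k * (\<rho> / k)"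
    by (simp add: k_def algebra_simps diff_divide_distrib)
  then have "axis i t \<in> feasible_set D r \<rho> \<gamma>"
    using k by (simp add: feasible_set_def)
  moreover have "t \<noteq> 0"
    using abs_t \<rho> k by auto
  then have "{j. axis i t $ j \<noteq> 0} = {i}"
    by (auto simp: axis_def)
  then have "norm0 (axis i t) = 1"
    by (simp add: norm0_def)
  ultimately show thesis
    using that form by (simp add: k_def)
qed

lemma one_le_norm0: "x \<noteq> 0 \<Longrightarrow> 1 \<le> norm0 x"
  by (auto simp: norm0_def vec_eq_iff Suc_le_eq card_gt_0_iff)

theorem proposition5:
  fixes D :: "real^'n^'n"
    and r_hat r x_hat :: "real^'n"
    and r_c r_bar \<rho> \<gamma> \<beta> \<eta> :: real
  assumes D: "symmetric_pos_def D"
    and r: "r = r_hat - r_c *\<^sub>R 1"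
    and \<rho>: "\<rho> = r_bar - r_c"
    and \<gamma>: "\<gamma> > 0"
    and r_bar: "r_bar > r_c"
    and min_ratio: "(MIN i. \<bar>r $ i\<bar> / sqrt (D $ i $ i)) > \<gamma>"
    and \<beta>: "\<beta> > 0"
    and minimizer: "is_arg_min (objective D \<beta>) (\<lambda>x. x \<in> feasible_set D r \<rho> \<gamma>) x_hat"
    and \<eta>: "\<eta> = (MIN i. \<rho>\<^sup>2 * D $ i $ i / (\<bar>r $ i\<bar> - \<gamma> * sqrt (D $ i $ i))\<^sup>2)"
  shows "infnorm x_hat \<le> sqrt (\<eta> / smallest_singular_value D)
         \<and> 0 < smallest_singular_value D"
proof -
  have \<rho>_pos: "0 < \<rho>"
    using \<rho> r_bar by simp
  have s_pos: "0 < smallest_singular_value D"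
    using D by (rule smallest_singular_value_pos)
  have diag: "0 < D $ i $ i" for i
  proof -
    have "0 < axis i 1 \<bullet> (D *v axis i 1)"
      using D by (simp add: symmetric_pos_def_def axis_eq_0_iff)
    then show ?thesis
      by (simp add: quadratic_form_axis)
  qed
  have excess: "\<gamma> * sqrt (D $ i $ i) < \<bar>r $ i\<bar>" for i
  proof -
    have "\<gamma> < \<bar>r $ i\<bar> / sqrt (D $ i $ i)"
      using min_ratio by simp
    then show ?thesis
      using diag[of i] by (simp add: pos_less_divide_eq)
  qed
  have "\<eta> \<in> range (\<lambda>i. \<rho>\<^sup>2 * D $ i $ i / (\<bar>r $ i\<bar> - \<gamma> * sqrt (D $ i $ i))\<^sup>2)"
    unfolding \<eta> by (rule Min_in) auto
  then obtain i where i: "\<eta> = \<rho>\<^sup>2 * D $ i $ i / (\<bar>r $ i\<bar> - \<gamma> * sqrt (D $ i $ i))\<^sup>2"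
    by auto
  obtain w where w: "w \<in> feasible_set D r \<rho> \<gamma>" "norm0 w = 1" "w \<bullet> (D *v w) = \<eta>"
    using single_asset_feasible[OF diag \<rho>_pos \<gamma> excess] i by metis
  have "0 \<notin> feasible_set D r \<rho> \<gamma>"
    using \<rho>_pos by (simp add: feasible_set_def norm_wrt_def)
  then have "x_hat \<noteq> 0"
    using minimizer by (auto simp: is_arg_min_def)
  then have "\<beta> * 1 \<le> \<beta> * real (norm0 x_hat)"
    using one_le_norm0[of x_hat] \<beta> by (intro mult_left_mono) simp_all
  moreover have "objective D \<beta> x_hat \<le> objective D \<beta> w"
    using minimizer w(1) by (auto simp: is_arg_min_linorder)
  ultimately have "x_hat \<bullet> (D *v x_hat) \<le> \<eta>"
    using w by (simp add: objective_def)
  then have "smallest_singular_value D * (norm x_hat)\<^sup>2 \<le> \<eta>"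
    using smallest_singular_value_coercive[OF D, of x_hat] by linarith
  then have "(norm x_hat)\<^sup>2 \<le> \<eta> / smallest_singular_value D"
    using s_pos by (simp add: pos_le_divide_eq mult.commute)
  then have "norm x_hat \<le> sqrt (\<eta> / smallest_singular_value D)"
    by (rule real_le_rsqrt)
  then show ?thesis
    using infnorm_le_norm[of x_hat] s_pos by linarith
qed

end
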